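(* Let $E$ be a finite-dimensional real vector space, $Q\subset E$ nonempty, convex and compact, and $h:Q\to\mathbb{R}$ concave and differentiable on $Q$, with finite curvature constant $C_{h,Q}$. Let $\{\lambda_k\}_{k\ge1}$, $\{\tilde\lambda_k\}_{k\ge1}$, $\{B_k\}_{k\ge0}$ and $\{G_k\}_{k\ge1}$ be the iterates, upper bounds on $h^*=\max_{\lambda\in Q}h(\lambda)$ and FW gaps generated by the Frank-Wolfe method with approximate subproblem solutions, with accuracies $\delta_k\ge0$ and an arbitrary step-size sequence $\{\bar\alpha_k\}_{k\ge1}\subset[0,1)$, and let $\{\alpha_k\},\{\beta_k\}$ be the associated dual averages sequences. Then for every $\ell\ge0$ and $k\ge\ell+1$ such that $\sum_{i=\ell+1}^k\bar\alpha_i>0$: $$\min_{i\in\{\ell+1,\ldots,k\}}G_i\le\frac{1}{\sum_{i=\ell+1}^k\bar\alpha_i}\left[\frac{B_\ell-h(\lambda_1)}{\beta_{\ell+1}}+\frac{\frac12C_{h,Q}\sum_{i=1}^\ell\frac{\alpha_i^2}{\beta_{i+1}}}{\beta_{\ell+1}}+\frac{\sum_{i=1}^\ell\alpha_i\delta_i}{\beta_{\ell+1}}\right]+\frac{\frac12C_{h,Q}\sum_{i=\ell+1}^k\bar\alpha_i^2}{\sum_{i=\ell+1}^k\bar\alpha_i}+\frac{\sum_{i=\ell+1}^k\bar\alpha_i\delta_i}{\sum_{i=\ell+1}^k\bar\alpha_i}.$$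
   Context: Notation: $E^*$ is the dual space of $E$ and $s^T\lambda$ is the evaluation of $s\in E^*$ at $\lambda\in E$; $\nabla h(\lambda)\in E^*$. Curvature constant: $C_{h,Q}$ is the minimal $C$ such that $h(\lambda+\alpha(\bar\lambda-\lambda))\ge h(\lambda)+\nabla h(\lambda)^T(\alpha(\bar\lambda-\lambda))-\frac12 C\alpha^2$ for all $\lambda,\bar\lambda\in Q$ and all $\alpha\in[0,1]$ (assumed finite). Approximate solutions: for $\delta\ge0$ and $c\in E^*$, a $\delta$-approximate solution of $\max_{\lambda\in Q}c^T\lambda$ is a point $\tilde\lambda\in Q$ with $c^T\tilde\lambda\ge\max_{\lambda\in Q}c^T\lambda-\delta$. Frank-Wolfe method with approximate subproblem solutions: start at $\lambda_1\in Q$ with an upper bound $B_0\ge h^*$ ($B_0=+\infty$ allowed if no bound is available, inequalities being then read in the extended reals). At iteration $k\ge1$: let $\tilde\lambda_k$ be any $\delta_k$-approximate solution of $\max_{\lambda\in Q}\{h(\lambda_k)+\nabla h(\lambda_k)^T(\lambda-\lambda_k)\}$ (equivalently of $\max_{\lambda\in Q}\nabla h(\lambda_k)^T\lambda$); set $B^w_k=h(\lambda_k)+\nabla h(\lambda_k)^T(\tilde\lambda_k-\lambda_k)+\delta_k$ and the FW gap $G_k=\nabla h(\lambda_k)^T(\tilde\lambda_k-\lambda_k)+\delta_k$; set $B_k=\min\{B_{k-1},B^w_k,B^o_k\}$, where $B^o_k\ge h^*$ is any other (optional) upper bound on $h^*$ (omitted, or $+\infty$, if not computed); set $\lambda_{k+1}=\lambda_k+\bar\alpha_k(\tilde\lambda_k-\lambda_k)$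 with $\bar\alpha_k\in[0,1)$. Dual averages sequences: $\beta_k=\frac{1}{\prod_{j=1}^{k-1}(1-\bar\alpha_j)}$ and $\alpha_k=\frac{\beta_k\bar\alpha_k}{1-\bar\alpha_k}$ for $k\ge1$. Empty products equal $1$, empty sums equal $0$. *)

theory Defs
  imports "HOL-Analysis.Analysis"
begin

text \<open>The dual space \<open>E\<^sup>*\<close> is the type \<open>'a \<Rightarrow>\<^sub>L real\<close> of bounded linear functionals; in finite
  dimension every linear functional is bounded.  A gradient map for \<open>h\<close> is a function
  \<open>dh :: 'a \<Rightarrow> 'a \<Rightarrow>\<^sub>L real\<close>.\<close>

definition max_on :: "'a set \<Rightarrow> ('a \<Rightarrow> real) \<Rightarrow> real" where
  "max_on Q f = (GREATEST v. v \<in> f ` Q)"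

lemma max_on_attained:
  fixes f :: "'a::topological_space \<Rightarrow> real"
  assumes "compact Q" "Q \<noteq> {}" "continuous_on Q f"
  shows "\<exists>x\<in>Q. f x = max_on Q f \<and> (\<forall>y\<in>Q. f y \<le> f x)"
proof -
  obtain x where x: "x \<in> Q" "\<forall>y\<in>Q. f y \<le> f x"
    using continuous_attains_sup[OF assms] by blast
  have "max_on Q f = f x"
    unfolding max_on_def using x by (intro Greatest_equality) auto
  with x show ?thesis by auto
qed

definition curvature_bound ::
    "('a::real_normed_vector \<Rightarrow> real) \<Rightarrow> ('a \<Rightarrow> 'a \<Rightarrow>\<^sub>L real) \<Rightarrow> 'a set \<Rightarrow> real \<Rightarrow> bool" where
  "curvature_bound h dh Q C \<longleftrightarrow>
     (\<forall>x\<in>Q. \<forall>y\<in>Q. \<forall>\<alpha>\<in>{0..1}.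
        h (x + \<alpha> *\<^sub>R (y - x)) \<ge> h x + blinfun_apply (dh x) (\<alpha> *\<^sub>R (y - x)) - 1/2 * C * \<alpha>\<^sup>2)"

definition curvature_const ::
    "('a::real_normed_vector \<Rightarrow> real) \<Rightarrow> ('a \<Rightarrow> 'a \<Rightarrow>\<^sub>L real) \<Rightarrow> 'a set \<Rightarrow> real" where
  "curvature_const h dh Q = (LEAST C. curvature_bound h dh Q C)"

lemma curvature_const_attained:
  assumes "Q \<noteq> {}" "curvature_bound h dh Q C\<^sub>0"
  shows "curvature_bound h dh Q (curvature_const h dh Q)"
    and "\<And>C. curvature_bound h dh Q C \<Longrightarrow> curvature_const h dh Q \<le> C"
proof -
  let ?S = "{C. curvature_bound h dh Q C}"
  have nonneg: "0 \<le> C" if "curvature_bound h dh Q C" for C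
  proof -
    obtain x where "x \<in> Q" using assms(1) by blast
    then have "h (x + 1 *\<^sub>R (x - x)) \<ge> h x + blinfun_apply (dh x) (1 *\<^sub>R (x - x)) - 1/2 * C * 1\<^sup>2"
      using that unfolding curvature_bound_def by (metis atLeastAtMost_iff order_refl zero_le_one)
    then show ?thesis by simp
  qed
  have bdd: "bdd_below ?S" using nonneg by (intro bdd_belowI[of _ 0]) auto
  have "?S = (\<Inter>x\<in>Q. \<Inter>y\<in>Q. \<Inter>\<alpha>\<in>{0..1}.
      {C. h x + blinfun_apply (dh x) (\<alpha> *\<^sub>R (y - x)) - 1/2 * C * \<alpha>\<^sup>2 \<le> h (x + \<alpha> *\<^sub>R (y - x))})"
    unfolding curvature_bound_def by auto
  moreover have "closed \<dots>"
    by (intro closed_INT ballI closed_Collect_le continuous_intros)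
  ultimately have "closed ?S" by simp
  then have Inf: "curvature_bound h dh Q (Inf ?S)"
    using closed_contains_Inf[of ?S] bdd assms(2) by blast
  have le: "Inf ?S \<le> C" if "curvature_bound h dh Q C" for C
    using that bdd by (simp add: cInf_lower)
  have eq: "curvature_const h dh Q = Inf ?S"
    unfolding curvature_const_def using Inf le by (intro Least_equality) auto
  show "curvature_bound h dh Q (curvature_const h dh Q)" using Inf eq by simp
  show "curvature_const h dh Q \<le> C" if "curvature_bound h dh Q C" for C
    using le[OF that] eq by simp
qed

definition approx_solution ::
    "'a::real_normed_vector set \<Rightarrow> ('a \<Rightarrow>\<^sub>L real) \<Rightarrow> real \<Rightarrow> 'a \<Rightarrow> bool" where
  "approx_solution Q c \<delta> x \<longleftrightarrow>
     x \<in> Q \<and> blinfun_apply c x \<ge> max_on Q (blinfun_apply c) - \<delta>"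

text \<open>In a run, \<open>a\<close> is the step-size sequence \<open>\<alpha>\<close>-bar, \<open>lam\<close> and \<open>lamt\<close> are the iterates and the
  approximate subproblem solutions, and \<open>Bo\<close> collects the optional upper bounds, with \<open>Bo k = \<infinity>\<close>
  when none is computed.  The initial bound \<open>B 0\<close> may be \<open>\<infinity>\<close>, so bounds are extended reals.
  The index 0 is meaningful for \<open>B\<close> only.\<close>

definition FW_gap ::
    "('a::real_normed_vector \<Rightarrow> 'a \<Rightarrow>\<^sub>L real) \<Rightarrow> (nat \<Rightarrow> real) \<Rightarrow> (nat \<Rightarrow> 'a) \<Rightarrow> (nat \<Rightarrow> 'a) \<Rightarrow> nat \<Rightarrow> real"
  where "FW_gap dh \<delta> lam lamt k = blinfun_apply (dh (lam k)) (lamt k - lam k) + \<delta> k"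

definition Wolfe_bound ::
    "('a::real_normed_vector \<Rightarrow> real) \<Rightarrow> ('a \<Rightarrow> 'a \<Rightarrow>\<^sub>L real) \<Rightarrow> (nat \<Rightarrow> real) \<Rightarrow> (nat \<Rightarrow> 'a) \<Rightarrow>
      (nat \<Rightarrow> 'a) \<Rightarrow> nat \<Rightarrow> real"
  where "Wolfe_bound h dh \<delta> lam lamt k =
     h (lam k) + blinfun_apply (dh (lam k)) (lamt k - lam k) + \<delta> k"

definition FW_run ::
    "'a::real_normed_vector set \<Rightarrow> ('a \<Rightarrow> real) \<Rightarrow> ('a \<Rightarrow> 'a \<Rightarrow>\<^sub>L real) \<Rightarrow> (nat \<Rightarrow> real) \<Rightarrow>
      (nat \<Rightarrow> real) \<Rightarrow> (nat \<Rightarrow> 'a) \<Rightarrow> (nat \<Rightarrow> 'a) \<Rightarrow> (nat \<Rightarrow> ereal) \<Rightarrow> (nat \<Rightarrow> ereal) \<Rightarrow>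
      (nat \<Rightarrow> real) \<Rightarrow> bool" where
  "FW_run Q h dh \<delta> a lam lamt Bo B G \<longleftrightarrow>
     lam 1 \<in> Q \<and> ereal (max_on Q h) \<le> B 0 \<and>
     (\<forall>k\<ge>1.
        approx_solution Q (dh (lam k)) (\<delta> k) (lamt k) \<and>
        G k = FW_gap dh \<delta> lam lamt k \<and>
        ereal (max_on Q h) \<le> Bo k \<and>
        B k = Min {B (k - 1), ereal (Wolfe_bound h dh \<delta> lam lamt k), Bo k} \<and>
        lam (k + 1) = lam k + a k *\<^sub>R (lamt k - lam k))"

definition dual_beta :: "(nat \<Rightarrow> real) \<Rightarrow> nat \<Rightarrow> real" where
  "dual_beta a k = 1 / (\<Prod>j\<in>{1..<k}. 1 - a j)"

definition dual_alpha :: "(nat \<Rightarrow> real) \<Rightarrow> nat \<Rightarrow> real" where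
  "dual_alpha a k = dual_beta a k * a k / (1 - a k)"

end

theory Submission
  imports Defs
begin

text \<open>The curvature inequality gives
  \<open>h(\<lambda>\<^sub>i\<^sub>+\<^sub>1) \<ge> h(\<lambda>\<^sub>i) + a\<^sub>i (G\<^sub>i - \<delta>\<^sub>i) - C a\<^sub>i\<^sup>2 / 2\<close>.  Summing over \<open>i = l+1, \<dots>, k\<close> and using
  \<open>h(\<lambda>\<^sub>k\<^sub>+\<^sub>1) \<le> h\<^sup>* \<le> B\<^sub>l\<close> bounds the weighted average of the gaps by \<open>B\<^sub>l - h(\<lambda>\<^sub>l\<^sub>+\<^sub>1)\<close> plus error terms.
  For \<open>i \<le> l\<close> the Wolfe bound yields \<open>G\<^sub>i \<ge> B\<^sub>i - h(\<lambda>\<^sub>i) \<ge> B\<^sub>l - h(\<lambda>\<^sub>i)\<close>, so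
  \<open>B\<^sub>l - h(\<lambda>\<^sub>i)\<close> contracts by the factor \<open>1 - a\<^sub>i = \<beta>\<^sub>i / \<beta>\<^sub>i\<^sub>+\<^sub>1\<close> up to errors, which
  bounds \<open>B\<^sub>l - h(\<lambda>\<^sub>l\<^sub>+\<^sub>1)\<close> by the starting gap divided by \<open>\<beta>\<^sub>l\<^sub>+\<^sub>1\<close>.\<close>

text \<open>Restrict \<open>h\<close> to the segment from \<open>x\<close> to \<open>y\<close>: by
  concavity every difference quotient at \<open>t\<close> in (0,1] is at least
  \<open>h y - h x\<close>, and the quotients tend to \<open>h' (y - x)\<close> as \<open>t\<close>
  tends to 0. The limit is one-sided and stays inside \<open>Q\<close>, so differentiability within
  \<open>Q\<close> is enough, also at boundary points.\<close>

lemma concave_on_le_tangent: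
  fixes h :: "'a::real_normed_vector \<Rightarrow> real"
  assumes conc: "concave_on Q h" and x: "x \<in> Q" and y: "y \<in> Q"
    and der: "(h has_derivative h') (at x within Q)"
  shows "h y \<le> h x + h' (y - x)"
proof -
  define p where "p t = x + t *\<^sub>R (y - x)" for t :: real
  have "convex Q" using conc by (simp add: concave_on_imp_convex)
  then have p_in: "p ` {0..1} \<subseteq> Q"
    using x y by (auto simp: p_def convex_alt algebra_simps)
  have p_der: "(p has_derivative (\<lambda>t. t *\<^sub>R (y - x))) (at 0 within {0..1})"
    unfolding p_def by (auto intro!: derivative_eq_intros)
  have "(h has_derivative h') (at (p 0) within p ` {0..1})"
    using has_derivative_subset[OF der p_in] by (simp add: p_def)
  then have "((\<lambda>t. h (p t)) has_derivative (\<lambda>t. h' (t *\<^sub>R (y - x)))) (at 0 within {0..1})"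
    by (rule has_derivative_in_compose[OF p_der])
  moreover have "h' (t *\<^sub>R (y - x)) = h' (y - x) * t" for t
    using linear_cmul[OF has_derivative_linear[OF der]] by simp
  ultimately have "((\<lambda>t. h (p t)) has_field_derivative h' (y - x)) (at 0 within {0..1})"
    by (simp add: has_field_derivative_def)
  then have lim: "((\<lambda>t. (h (p t) - h x) / t) \<longlongrightarrow> h' (y - x)) (at 0 within {0..1})"
    by (simp add: has_field_derivative_iff p_def)
  have slope: "h y - h x \<le> (h (p t) - h x) / t" if "t \<in> {0..1}" "t \<noteq> 0" for t
  proof -
    have "p t = (1 - t) *\<^sub>R x + t *\<^sub>R y" by (simp add: p_def algebra_simps)
    then have "(1 - t) * h x + t * h y \<le> h (p t)"
      using concave_onD[OF conc, of t x y] that x y by simp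
    with that show ?thesis by (simp add: field_simps)
  qed
  have "\<forall>\<^sub>F t in at 0 within {0..1}. h y - h x \<le> (h (p t) - h x) / t"
    using slope by (auto simp: eventually_at_filter)
  \<comment> \<open>A bound passes to the limit only along a nontrivial filter.\<close>
  moreover have "at (0::real) within {0..1} \<noteq> bot"
    by (simp add: trivial_limit_within islimpt_Icc)
  ultimately have "h y - h x \<le> h' (y - x)"
    using tendsto_lowerbound[OF lim] by blast
  then show ?thesis by simp
qed

lemma dual_beta_1 [simp]: "dual_beta a (Suc 0) = 1"
  by (simp add: dual_beta_def)

lemma dual_beta_Suc:
  assumes "1 \<le> k"
  shows "dual_beta a (Suc k) = dual_beta a k / (1 - a k)"
  using assms by (simp add: dual_beta_def prod.atLeastLessThan_Suc)

lemma dual_beta_pos: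
  assumes "\<And>i. i \<ge> 1 \<Longrightarrow> a i < 1"
  shows "0 < dual_beta a k"
  using assms by (auto simp: dual_beta_def intro!: prod_pos)

text \<open>Measured against a fixed level \<open>b\<close>, the gap \<open>b - H i\<close> shrinks
  by the factor \<open>1 - a i\<close> up to errors. Weighting it by \<open>dual_beta a i\<close>
  absorbs that factor, so only the errors accumulate. In the application \<open>b\<close> is the
  final bound \<open>B l\<close>, the same for all \<open>i\<close>.\<close>

lemma dual_averages_gap_bound:
  assumes a: "\<And>i. i \<ge> 1 \<Longrightarrow> a i < 1"
    and ascent: "\<And>i. i \<in> {1..l} \<Longrightarrow>
      H i + a i * (b - H i - \<delta> i) - 1/2 * C * (a i)\<^sup>2 \<le> H (Suc i)"
  shows "dual_beta a (Suc l) * (b - H (Suc l)) \<le> b - H 1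
      + 1/2 * C * (\<Sum>i=1..l. (dual_alpha a i)\<^sup>2 / dual_beta a (Suc i))
      + (\<Sum>i=1..l. dual_alpha a i * \<delta> i)"
  using ascent
proof (induction l)
  case 0
  then show ?case by simp
next
  case (Suc l)
  let ?n = "Suc l" and ?\<beta> = "dual_beta a"
  have pos: "0 < ?\<beta> (Suc ?n)" using dual_beta_pos a by blast
  have a1: "a ?n < 1" using a by simp
  have \<beta>: "?\<beta> ?n = ?\<beta> (Suc ?n) * (1 - a ?n)" and \<alpha>: "dual_alpha a ?n = ?\<beta> (Suc ?n) * a ?n"
    using a1 by (simp_all add: dual_beta_Suc dual_alpha_def)
  have "b - H (Suc ?n) \<le> (1 - a ?n) * (b - H ?n) + a ?n * \<delta> ?n + 1/2 * C * (a ?n)\<^sup>2"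
    using Suc.prems[of ?n] by (simp add: algebra_simps)
  from mult_left_mono[OF this less_imp_le[OF pos]]
  have "?\<beta> (Suc ?n) * (b - H (Suc ?n)) \<le> ?\<beta> ?n * (b - H ?n)
      + dual_alpha a ?n * \<delta> ?n + 1/2 * C * (?\<beta> (Suc ?n) * (a ?n)\<^sup>2)"
    by (simp add: \<beta> \<alpha> algebra_simps)
  \<comment> \<open>Since \<open>dual_alpha a ?n\<close> is \<open>a ?n\<close> scaled by the next
    weight, squaring it produces one weight too many.\<close>
  also have "?\<beta> (Suc ?n) * (a ?n)\<^sup>2 = (dual_alpha a ?n)\<^sup>2 / ?\<beta> (Suc ?n)"
    using pos by (simp add: \<alpha> power2_eq_square)
  finally have step: "?\<beta> (Suc ?n) * (b - H (Suc ?n)) \<le> ?\<beta> ?n * (b - H ?n)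
      + dual_alpha a ?n * \<delta> ?n + 1/2 * C * ((dual_alpha a ?n)\<^sup>2 / ?\<beta> (Suc ?n))" .
  have IH: "?\<beta> ?n * (b - H ?n) \<le> b - H 1
      + 1/2 * C * (\<Sum>i=1..l. (dual_alpha a i)\<^sup>2 / ?\<beta> (Suc i))
      + (\<Sum>i=1..l. dual_alpha a i * \<delta> i)"
    using Suc.prems by (intro Suc.IH) simp
  have "(\<Sum>i=1..?n. (dual_alpha a i)\<^sup>2 / ?\<beta> (Suc i))
      = (\<Sum>i=1..l. (dual_alpha a i)\<^sup>2 / ?\<beta> (Suc i)) + (dual_alpha a ?n)\<^sup>2 / ?\<beta> (Suc ?n)"
    and "(\<Sum>i=1..?n. dual_alpha a i * \<delta> i)
      = (\<Sum>i=1..l. dual_alpha a i * \<delta> i) + dual_alpha a ?n * \<delta> ?n" by simp_all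
  with step IH show ?case by (simp only: distrib_left)
qed

text \<open>The weights are nonnegative, so the minimum times their sum is at most the weighted sum
  of the \<open>G i\<close>, and the ascent inequalities bound that sum by a telescoping
  one.\<close>

lemma weighted_Min_le:
  fixes a G \<delta> H :: "nat \<Rightarrow> real"
  assumes a: "\<And>i. i \<in> {m..k} \<Longrightarrow> 0 \<le> a i" and mk: "m \<le> k"
    and ascent: "\<And>i. i \<in> {m..k} \<Longrightarrow>
      H i + a i * (G i - \<delta> i) - 1/2 * C * (a i)\<^sup>2 \<le> H (Suc i)"
  shows "Min (G ` {m..k}) * (\<Sum>i=m..k. a i) \<le> H (Suc k) - H m
      + 1/2 * C * (\<Sum>i=m..k. (a i)\<^sup>2) + (\<Sum>i=m..k. a i * \<delta> i)"
proof -
  have "Min (G ` {m..k}) * (\<Sum>i=m..k. a i) \<le> (\<Sum>i=m..k. a i * G i)"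
    unfolding sum_distrib_left mult.commute[of "Min _"] using a
    by (intro sum_mono mult_left_mono) auto
  also have "\<dots> \<le> (\<Sum>i=m..k. (H (Suc i) - H i) + 1/2 * C * (a i)\<^sup>2 + a i * \<delta> i)"
    using ascent by (intro sum_mono) (fastforce simp: algebra_simps)
  also have "\<dots> = (\<Sum>i=m..k. H (Suc i) - H i)
      + 1/2 * C * (\<Sum>i=m..k. (a i)\<^sup>2) + (\<Sum>i=m..k. a i * \<delta> i)"
    by (simp only: sum.distrib sum_distrib_left)
  also have "(\<Sum>i=m..k. H (Suc i) - H i) = H (Suc k) - H m"
    using mk by (simp add: sum_Suc_diff)
  finally show ?thesis .
qed

lemma max_on_ge:
  fixes f :: "'a::topological_space \<Rightarrow> real"
  assumes "compact Q" "continuous_on Q f" "x \<in> Q"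
  shows "f x \<le> max_on Q f"
  using max_on_attained[OF assms(1) _ assms(2)] assms(3) by fastforce

lemma FW_run_in:
  assumes run: "FW_run Q h dh \<delta> a lam lamt Bo B G" and "convex Q"
    and a: "\<And>i. i \<ge> 1 \<Longrightarrow> 0 \<le> a i \<and> a i < 1" and k: "1 \<le> k"
  shows "lam k \<in> Q" "lamt k \<in> Q"
proof -
  have lamt: "lamt i \<in> Q" if "1 \<le> i" for i
    using run that by (simp add: FW_run_def approx_solution_def)
  show "lam k \<in> Q" using k
  proof (induction k rule: dec_induct)
    case base
    then show ?case using run by (simp add: FW_run_def)
  next
    case (step n)
    have "lam (Suc n) = (1 - a n) *\<^sub>R lam n + a n *\<^sub>R lamt n"
      using run step.hyps by (simp add: FW_run_def algebra_simps)
    moreover have "\<dots> \<in> Q"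
      using \<open>convex Q\<close> step.IH lamt[OF step.hyps(1)] a[OF step.hyps(1)]
      by (simp add: convex_alt)
    ultimately show ?case by simp
  qed
  show "lamt k \<in> Q" using lamt k .
qed

text \<open>The curvature inequality along the step actually taken. The gap has
  \<open>\<delta> k\<close> built in, so the directional derivative is
  \<open>G k - \<delta> k\<close>.\<close>

lemma FW_run_ascent:
  assumes run: "FW_run Q h dh \<delta> a lam lamt Bo B G" and "convex Q"
    and a: "\<And>i. i \<ge> 1 \<Longrightarrow> 0 \<le> a i \<and> a i < 1" and k: "1 \<le> k"
    and curv: "curvature_bound h dh Q C"
  shows "h (lam k) + a k * (G k - \<delta> k) - 1/2 * C * (a k)\<^sup>2 \<le> h (lam (Suc k))"
proof -
  have "h (lam k) + blinfun_apply (dh (lam k)) (a k *\<^sub>R (lamt k - lam k)) - 1/2 * C * (a k)\<^sup>2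
      \<le> h (lam k + a k *\<^sub>R (lamt k - lam k))"
    using curv FW_run_in[OF run \<open>convex Q\<close> a k] a[OF k]
    unfolding curvature_bound_def by (meson atLeastAtMost_iff less_imp_le)
  then show ?thesis
    using run k by (simp add: FW_run_def FW_gap_def blinfun.scaleR_right)
qed

text \<open>The tangent at \<open>lam k\<close> lies above \<open>h\<close> at a maximiser. An
  approximate subproblem solution loses at most \<open>\<delta> k\<close> on the tangent's maximum,
  which the Wolfe bound adds back.\<close>

lemma max_on_le_Wolfe_bound:
  assumes Q: "Q \<noteq> {}" "compact Q" and conc: "concave_on Q h" and x: "lam k \<in> Q"
    and diff: "\<And>x. x \<in> Q \<Longrightarrow> (h has_derivative blinfun_apply (dh x)) (at x within Q)"
    and approx: "approx_solution Q (dh (lam k)) (\<delta> k) (lamt k)"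
  shows "max_on Q h \<le> Wolfe_bound h dh \<delta> lam lamt k"
proof -
  have "continuous_on Q h"
    using diff by (meson continuous_on_eq_continuous_within has_derivative_continuous)
  with Q obtain y where y: "y \<in> Q" "h y = max_on Q h" using max_on_attained by blast
  have "h y \<le> h (lam k) + blinfun_apply (dh (lam k)) (y - lam k)"
    using concave_on_le_tangent[OF conc x y(1) diff[OF x]] .
  moreover have "blinfun_apply (dh (lam k)) y \<le> max_on Q (blinfun_apply (dh (lam k)))"
    using Q y by (intro max_on_ge continuous_intros)
  ultimately show ?thesis
    using approx y(2) by (simp add: approx_solution_def Wolfe_bound_def blinfun.diff_right)
qed

lemma FW_run_bound_antimono:
  assumes "FW_run Q h dh \<delta> a lam lamt Bo B G" and "i \<le> l"
  shows "B l \<le> B i"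
proof (rule lift_Suc_antimono_le[OF _ assms(2)])
  show "B (Suc n) \<le> B n" for n using assms(1) by (simp add: FW_run_def)
qed

text \<open>Serves twice: it puts \<open>h (lam (Suc k))\<close> below \<open>B l\<close>, and it
  rules out the value minus infinity for \<open>B l\<close>.\<close>

lemma FW_run_bound_ge:
  assumes run: "FW_run Q h dh \<delta> a lam lamt Bo B G"
    and Wolfe: "\<And>k. 1 \<le> k \<Longrightarrow> max_on Q h \<le> Wolfe_bound h dh \<delta> lam lamt k"
  shows "ereal (max_on Q h) \<le> B l"
proof (induction l)
  case 0
  then show ?case using run by (simp add: FW_run_def)
next
  case (Suc l)
  then show ?case using run Wolfe[of "Suc l"] by (simp add: FW_run_def)
qed

theorem theorem5p2:
  fixes Q :: "'a::real_normed_vector set"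
    and h :: "'a \<Rightarrow> real"
    and dh :: "'a \<Rightarrow> 'a \<Rightarrow>\<^sub>L real"
    and \<delta> a G :: "nat \<Rightarrow> real"
    and lam lamt :: "nat \<Rightarrow> 'a"
    and Bo B :: "nat \<Rightarrow> ereal"
    and l k :: nat
  assumes findim: "\<exists>D :: 'a set. finite D \<and> span D = UNIV"
    and Q: "Q \<noteq> {}" "convex Q" "compact Q"
    and conc: "concave_on Q h"
    and diff: "\<And>x. x \<in> Q \<Longrightarrow> (h has_derivative blinfun_apply (dh x)) (at x within Q)"
    and curv_finite: "\<exists>C. curvature_bound h dh Q C"
    and delta: "\<And>i. i \<ge> 1 \<Longrightarrow> 0 \<le> \<delta> i"
    and step: "\<And>i. i \<ge> 1 \<Longrightarrow> 0 \<le> a i \<and> a i < 1"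
    and run: "FW_run Q h dh \<delta> a lam lamt Bo B G"
    and kl: "l + 1 \<le> k"
    and pos: "(\<Sum>i=l+1..k. a i) > 0"
  shows "ereal (Min (G ` {l+1..k})) \<le>
      ereal (1 / (\<Sum>i=l+1..k. a i)) *
        ((B l - ereal (h (lam 1))) / ereal (dual_beta a (l+1))
         + ereal ((1/2 * curvature_const h dh Q
              * (\<Sum>i=1..l. (dual_alpha a i)\<^sup>2 / dual_beta a (i+1))) / dual_beta a (l+1))
         + ereal ((\<Sum>i=1..l. dual_alpha a i * \<delta> i) / dual_beta a (l+1)))
      + ereal ((1/2 * curvature_const h dh Q * (\<Sum>i=l+1..k. (a i)\<^sup>2)) / (\<Sum>i=l+1..k. a i))
      + ereal ((\<Sum>i=l+1..k. a i * \<delta> i) / (\<Sum>i=l+1..k. a i))"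
proof -
  define C where "C = curvature_const h dh Q"
  define H where "H i = h (lam i)" for i
  define S where "S = (\<Sum>i=Suc l..k. a i)"
  define b where "b = dual_beta a (Suc l)"
  define X where "X = (\<Sum>i=1..l. (dual_alpha a i)\<^sup>2 / dual_beta a (Suc i))"
  define Y where "Y = (\<Sum>i=1..l. dual_alpha a i * \<delta> i)"
  define U where "U = (\<Sum>i=Suc l..k. (a i)\<^sup>2)"
  define V where "V = (\<Sum>i=Suc l..k. a i * \<delta> i)"
  have curv: "curvature_bound h dh Q C"
    using curv_finite curvature_const_attained(1)[OF Q(1)] unfolding C_def by blast
  have S: "0 < S" using pos by (simp add: S_def)
  have b: "0 < b" unfolding b_def using step by (intro dual_beta_pos) blast
  have lam: "lam i \<in> Q" if "1 \<le> i" for i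
    using FW_run_in(1)[OF run Q(2) step that] .
  have ascent: "H i + a i * (G i - \<delta> i) - 1/2 * C * (a i)\<^sup>2 \<le> H (Suc i)" if "1 \<le> i" for i
    using FW_run_ascent[OF run Q(2) step that curv] by (simp add: H_def)
  have Wolfe: "max_on Q h \<le> Wolfe_bound h dh \<delta> lam lamt i" if "1 \<le> i" for i
    using run that lam[OF that]
    by (intro max_on_le_Wolfe_bound Q conc diff) (simp_all add: FW_run_def)
  have B_ge: "ereal (max_on Q h) \<le> B l" using FW_run_bound_ge[OF run Wolfe] .
  show ?thesis
  proof (cases "B l")
    case (real r)
    have Gi: "r - H i \<le> G i" if "i \<in> {1..l}" for i
    proof -
      have "ereal r \<le> B i" using FW_run_bound_antimono[OF run, of i l] real that by simp
      also have "B i \<le> ereal (Wolfe_bound h dh \<delta> lam lamt i)"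
        using run that by (simp add: FW_run_def min_le_iff_disj)
      finally show ?thesis
        using run that by (simp add: FW_run_def FW_gap_def Wolfe_bound_def H_def)
    qed
    have early: "b * (r - H (Suc l)) \<le> r - H 1 + 1/2 * C * X + Y"
      unfolding b_def X_def Y_def
    proof (rule dual_averages_gap_bound)
      show "a i < 1" if "1 \<le> i" for i using step[OF that] by simp
      fix i assume i: "i \<in> {1..l}"
      \<comment> \<open>Replacing the gap by the smaller \<open>r - H i\<close> weakens the ascent
        inequality to the recursive form.\<close>
      have "a i * (r - H i - \<delta> i) \<le> a i * (G i - \<delta> i)"
        using Gi[OF i] step[of i] i by (intro mult_left_mono) auto
      then show "H i + a i * (r - H i - \<delta> i) - 1/2 * C * (a i)\<^sup>2 \<le> H (Suc i)"
        using ascent[of i] i by simp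
    qed
    have "continuous_on Q h"
      using diff by (meson continuous_on_eq_continuous_within has_derivative_continuous)
    then have "H (Suc k) \<le> max_on Q h"
      unfolding H_def by (intro max_on_ge Q lam) simp_all
    then have "H (Suc k) \<le> r" using B_ge real by simp
    moreover have "Min (G ` {Suc l..k}) * S \<le> H (Suc k) - H (Suc l) + 1/2 * C * U + V"
      unfolding S_def U_def V_def using step ascent kl by (intro weighted_Min_le) auto
    moreover have "r - H (Suc l) \<le> (r - H 1 + 1/2 * C * X + Y) / b"
      using early b by (simp add: pos_le_divide_eq mult.commute)
    \<comment> \<open>The level \<open>r\<close> links the two phases: it dominates
      \<open>H (Suc k)\<close>, so the late increase of \<open>H\<close> is at most the gap left by
      the early phase.\<close>
    ultimately have "Min (G ` {Suc l..k}) * S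
        \<le> ((r - H 1) / b + (1/2 * C * X) / b + Y / b) + 1/2 * C * U + V"
      by (simp add: add_divide_distrib)
    then have "Min (G ` {Suc l..k})
        \<le> (((r - H 1) / b + (1/2 * C * X) / b + Y / b) + 1/2 * C * U + V) / S"
      using S by (simp add: pos_le_divide_eq)
    then have "Min (G ` {Suc l..k})
        \<le> 1 / S * ((r - H 1) / b + (1/2 * C * X) / b + Y / b) + (1/2 * C * U) / S + V / S"
      by (simp add: add_divide_distrib)
    moreover have "(B l - ereal (h (lam 1))) / ereal b = ereal ((r - H 1) / b)"
      using b by (simp add: real H_def)
    ultimately show ?thesis
      by (simp only: Suc_eq_plus1[symmetric] C_def[symmetric] S_def[symmetric] b_def[symmetric]
          X_def[symmetric] Y_def[symmetric] U_def[symmetric] V_def[symmetric]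
          times_ereal.simps plus_ereal.simps ereal_less_eq)
  next
    \<comment> \<open>This occurs only for \<open>l = 0\<close> without a finite initial bound, as
      Wolfe bounds are real. Both \<open>1 / S\<close> and \<open>b\<close> are positive, so the
      right-hand side is infinite.\<close>
    case PInf
    have "(B l - ereal (h (lam 1))) / ereal b = \<infinity>"
      using b by (simp add: PInf divide_ereal_def)
    with S show ?thesis
      by (simp only: Suc_eq_plus1[symmetric] S_def[symmetric] b_def[symmetric]) simp
  next
    case MInf
    with B_ge show ?thesis by simp
  qed
qed

end
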